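(* Let $\{r_t\}_{t\in\mathbb{N}}$ be an i.i.d. sequence of $D$-valued random variables, $D\subseteq\mathbb{R}^p$, on a complete probability space, and consider $$x_{t+1}=x_t+\delta\,S(x_t,z_t,r_t),\qquad z_{t+1}=F(x_t,z_t,r_t),\qquad t\in\mathbb{N},$$ with $S:\mathbb{R}^n\times\mathbb{R}^m\times\mathbb{R}^p\to\mathbb{R}^n$, $F:\mathbb{R}^n\times\mathbb{R}^m\times\mathbb{R}^p\to\mathbb{R}^m$ and $\delta>0$. Suppose the following hold. (1) There are closed sets $X\subseteq\mathbb{R}^n$, $Z\subseteq\mathbb{R}^m$ such that $x+\delta' S(x,z,r)\in X$ and $F(x,z,r)\in Z$ for all $(x,z,r)\in X\times Z\times D$ and $\delta'\in[0,1]$. (2) There is a set-valued map $Z_{\mathrm{FIX}}:X\rightrightarrows Z$ with $Z_{\mathrm{FIX}}(x)$ nonempty and closed for all $x\in X$, such that $\bar z=F(x,\bar z,r)$ for all $r\in D$, $x\in X$, $\bar z\in Z_{\mathrm{FIX}}(x)$; moreover there is $L_{\mathrm{FIX}}>0$ with $d_F(z,Z_{\mathrm{FIX}}(x'))\le L_{\mathrm{FIX}}\,d_S(x,x')$ for all $x,x'\in X$ and $z\in Z_{\mathrm{FIX}}(x)$. (3) There is $c_F\in(0,1)$ with $\mathbb{E}[d_F(F(x,z,r),Z_{\mathrm{FIX}}(x))]\le c_F\,d_F(z,Z_{\mathrm{FIX}}(x))$ for all $(x,z)\in X\times Z$. (4) There is $R:\mathbb{R}^n\times D\to\mathbb{R}^n$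 with $R(x,r)=S(x,z,r)$ for all $x\in X$, $z\in Z_{\mathrm{FIX}}(x)$, $r\in D$. (5) There are $L_S,L_R>0$ with $\|S(x,z,r)-S(x,z',r)\|_S\le L_S\|z-z'\|_F$ and $\|R(x,r)-R(x',r)\|_S\le L_R\|x-x'\|_S$ for all $(x,z),(x',z')\in X\times Z$ and $r\in D$. Let $X_{\mathrm{fix}}:=\{x\in X\mid R(x,r)=0\text{ for all }r\in D\}$ and, for a constant $c_S$ specified below, let $$\bar\delta:=\frac{c_S(1-c_F)}{L_{\mathrm{FIX}}L_S(c_S+L_R)}.$$ (i) Suppose $X_{\mathrm{fix}}$ is nonempty and closed and, for some $\alpha\in(0,1)$ and $\mu\ge1$, $d_S(x+\tfrac1\alpha R(x,r),x'+\tfrac1\alpha R(x',r))\le\|x-x'\|_S$ and $d_S(x,X_{\mathrm{fix}})\le\mu\,\mathbb{E}[\|R(x,r)\|_S]$ for all $x,x'\in X$ and (in the first inequality) all $r\in D$. Let $c_S:=1-\sqrt{1-\frac{1-\alpha}{\alpha\mu^2}}$. Then, for all $\delta\in(0,\min\{\bar\delta,1\})$ and all (deterministic) $(x_0,z_0)\in X\times Z$, $$\lim_{t\to\infty}\left\|\begin{bmatrix}d_S(x_t,X_{\mathrm{fix}})\\ d_F(z_t,Z_{\mathrm{FIX}}(x_t))\end{bmatrix}\right\|=0\quad\text{almost surely.}$$ (ii) Suppose instead that there exist $x_\star\in X$ and $c_S\in(0,1)$ such that $X_{\mathrm{fix}}=\{x_\star\}$ and $\mathbb{E}[d_S(x+R(x,r),x_\star)]\le(1-c_S)\,d_S(x,x_\star)$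 for all $x\in X$. Then, for all $\delta\in(0,\min\{\bar\delta,1\})$ and all (deterministic) $(x_0,z_0)\in X\times Z$, $$\lim_{t\to\infty}\left\|\begin{bmatrix}d_S(x_t,x_\star)\\ d_F(z_t,Z_{\mathrm{FIX}}(x_t))\end{bmatrix}\right\|=0\quad\text{almost surely.}$$
   Context: $\|\cdot\|_F$ and $\|\cdot\|_S$ are norms induced by inner products on $\mathbb{R}^m$ and $\mathbb{R}^n$ respectively, with distances $d_F(z,z')=\|z-z'\|_F$ and $d_S(x,x')=\|x-x'\|_S$. For sets, $d_F(z,Z')=\inf_{y\in Z'}d_F(z,y)$ and $d_S(x,X')=\inf_{y\in X'}d_S(x,y)$. $\|\cdot\|$ (no subscript) is the Euclidean norm. In expectations involving $r$ with $x,z$ fixed, $r$ is a random variable with the common law of the $r_t$. The maps are understood to be Borel measurable, so that the expectations are meaningful. *)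

theory Defs
  imports "HOL-Probability.Probability"
begin

definition inner_product :: "('a::real_vector \<Rightarrow> 'a \<Rightarrow> real) \<Rightarrow> bool" where
  "inner_product B \<longleftrightarrow>
     bilinear B \<and> (\<forall>x y. B x y = B y x) \<and> (\<forall>x. x \<noteq> 0 \<longrightarrow> B x x > 0)"

definition ip_norm :: "('a \<Rightarrow> 'a \<Rightarrow> real) \<Rightarrow> 'a \<Rightarrow> real" where
  "ip_norm B x = sqrt (B x x)"

definition ip_dist :: "('a::real_vector \<Rightarrow> 'a \<Rightarrow> real) \<Rightarrow> 'a \<Rightarrow> 'a \<Rightarrow> real" where
  "ip_dist B x y = ip_norm B (x - y)"

(* Meaningful only for A \<noteq> {}, since Inf {} is unspecified on the reals. *)
definition ip_setdist :: "('a::real_vector \<Rightarrow> 'a \<Rightarrow> real) \<Rightarrow> 'a \<Rightarrow> 'a set \<Rightarrow> real" where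
  "ip_setdist B x A = (INF y\<in>A. ip_dist B x y)"

definition iid_seq :: "'w measure \<Rightarrow> (nat \<Rightarrow> 'w \<Rightarrow> 'r::topological_space) \<Rightarrow> bool" where
  "iid_seq M r \<longleftrightarrow>
     prob_space.indep_vars M (\<lambda>_. borel) r UNIV \<and>
     (\<forall>t. distr M borel (r t) = distr M borel (r 0))"

definition trajectory ::
  "'w measure \<Rightarrow> ('x::real_vector \<Rightarrow> 'z \<Rightarrow> 'r \<Rightarrow> 'x) \<Rightarrow> ('x \<Rightarrow> 'z \<Rightarrow> 'r \<Rightarrow> 'z) \<Rightarrow> (nat \<Rightarrow> 'w \<Rightarrow> 'r) \<Rightarrow>
   real \<Rightarrow> 'x \<Rightarrow> 'z \<Rightarrow> (nat \<Rightarrow> 'w \<Rightarrow> 'x) \<Rightarrow> (nat \<Rightarrow> 'w \<Rightarrow> 'z) \<Rightarrow> bool" where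
  "trajectory M S F r \<delta> x0 z0 x z \<longleftrightarrow>
     (\<forall>\<omega>\<in>space M. x 0 \<omega> = x0 \<and> z 0 \<omega> = z0 \<and>
        (\<forall>t. x (Suc t) \<omega> = x t \<omega> + \<delta> *\<^sub>R S (x t \<omega>) (z t \<omega>) (r t \<omega>) \<and>
             z (Suc t) \<omega> = F (x t \<omega>) (z t \<omega>) (r t \<omega>)))"

definition fix_set :: "'x set \<Rightarrow> 'r set \<Rightarrow> ('x \<Rightarrow> 'r \<Rightarrow> 'y::zero) \<Rightarrow> 'x set" where
  "fix_set X D R = {x \<in> X. \<forall>r\<in>D. R x r = 0}"

definition delta_bar :: "real \<Rightarrow> real \<Rightarrow> real \<Rightarrow> real \<Rightarrow> real \<Rightarrow> real" where
  "delta_bar c_S c_F L_FIX L_S L_R = c_S * (1 - c_F) / (L_FIX * L_S * (c_S + L_R))"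

end

theory Submission
  imports Defs
begin

text \<open>
  Write \<open>a = d_S(x, X_fix)\<close> and \<open>b = d_F(z, Z_FIX(x))\<close> for the slow and the fast error. In one step
  each error contracts on its own in expectation, up to a perturbation by the other one:
  the slow map is evaluated at \<open>z\<close> rather than at a fast equilibrium, which costs \<open>\<delta> L_S b\<close>
  (\<open>slow_step\<close>), and the fast equilibria move with \<open>x\<close>, which costs at most
  \<open>L_FIX \<delta> (L_R a + L_S b)\<close> (\<open>fast_step\<close>). The condition \<open>\<delta> < delta_bar\<close> is the small-gain condition
  under which some weighted sum \<open>V = a + w b\<close> satisfies \<open>E[V'] \<le> q V\<close> with \<open>q < 1\<close>
  (\<open>contraction_weight\<close>, \<open>expected_drift\<close>).

  The state at time \<open>t\<close> is a function of the noise before \<open>t\<close>, hence independent of the noise at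
  \<open>t\<close>, so the one-step bound integrates to \<open>E[V_t] \<le> q^t V_0\<close>. Then \<open>\<Sum>t. V_t\<close> has finite
  expectation, is almost surely finite, and \<open>V_t\<close> tends to zero almost surely
  (\<open>expected_contraction_AE_tendsto_0\<close>).

  Part (ii) assumes the contraction of the slow map in expectation. In part (i) it follows from
  averagedness and the error bound (\<open>averaged_contraction\<close>). As \<open>X_fix\<close> need not be convex, the slow
  error is controlled throughout by the distance to one closest point of \<open>X_fix\<close>; such points exist
  because the norm of an inner product on a finite-dimensional space is coercive.
\<close>

section \<open>Norms induced by inner products\<close>

locale ip =
  fixes B :: "'a::euclidean_space \<Rightarrow> 'a \<Rightarrow> real"
  assumes inner_product: "inner_product B"
begin

lemma bounded_bilinear: "bounded_bilinear B"
  using inner_product by (simp add: inner_product_def bilinear_conv_bounded_bilinear)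

lemma sym: "B x y = B y x"
  using inner_product by (simp add: inner_product_def)

lemma self_nonneg: "0 \<le> B x x"
  using inner_product bounded_bilinear.zero_left[OF bounded_bilinear]
  by (cases "x = 0") (auto simp: inner_product_def less_imp_le)

lemmas bilinear_simps =
  bounded_bilinear.add_left[OF bounded_bilinear] bounded_bilinear.add_right[OF bounded_bilinear]
  bounded_bilinear.diff_left[OF bounded_bilinear] bounded_bilinear.diff_right[OF bounded_bilinear]
  bounded_bilinear.scaleR_left[OF bounded_bilinear] bounded_bilinear.scaleR_right[OF bounded_bilinear]
  bounded_bilinear.zero_left[OF bounded_bilinear] bounded_bilinear.zero_right[OF bounded_bilinear]

lemma norm_nonneg [simp]: "0 \<le> ip_norm B x"
  by (simp add: ip_norm_def self_nonneg)

lemma norm_sq: "(ip_norm B x)\<^sup>2 = B x x"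
  by (simp add: ip_norm_def self_nonneg)

lemma norm_zero [simp]: "ip_norm B 0 = 0"
  by (simp add: ip_norm_def bilinear_simps)

lemma norm_scaleR: "ip_norm B (c *\<^sub>R x) = \<bar>c\<bar> * ip_norm B x"
  by (simp add: ip_norm_def bilinear_simps real_sqrt_mult)

lemma norm_minus_commute: "ip_norm B (x - y) = ip_norm B (y - x)"
  using norm_scaleR[of "-1" "x - y"] by simp

lemma Cauchy_Schwarz: "B x y \<le> ip_norm B x * ip_norm B y"
proof (cases "y = 0")
  case True
  then show ?thesis by (simp add: bilinear_simps)
next
  case False
  then have pos: "0 < B y y"
    using inner_product by (simp add: inner_product_def)
  define c where "c = B x y / B y y"
  have "0 \<le> B (x - c *\<^sub>R y) (x - c *\<^sub>R y)"
    by (rule self_nonneg)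
  also have "\<dots> = B x x - 2 * c * B x y + c * c * B y y"
    by (simp add: bilinear_simps sym[of y x] algebra_simps)
  also have "\<dots> = B x x - (B x y)\<^sup>2 / B y y"
    using pos by (simp add: c_def power2_eq_square field_simps)
  finally have "(B x y)\<^sup>2 \<le> B x x * B y y"
    using pos by (simp add: field_simps)
  then have "\<bar>B x y\<bar> \<le> sqrt (B x x * B y y)"
    by (rule real_le_rsqrt[of "\<bar>B x y\<bar>", simplified])
  then show ?thesis
    by (simp add: ip_norm_def real_sqrt_mult)
qed

lemma norm_triangle: "ip_norm B (x + y) \<le> ip_norm B x + ip_norm B y"
proof (rule power2_le_imp_le)
  have "(ip_norm B (x + y))\<^sup>2 = (ip_norm B x)\<^sup>2 + 2 * B x y + (ip_norm B y)\<^sup>2"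
    by (simp add: norm_sq bilinear_simps sym[of y x])
  also have "\<dots> \<le> (ip_norm B x + ip_norm B y)\<^sup>2"
    using Cauchy_Schwarz[of x y] by (simp add: power2_sum)
  finally show "(ip_norm B (x + y))\<^sup>2 \<le> (ip_norm B x + ip_norm B y)\<^sup>2" .
qed simp

lemma norm_diff_triangle: "ip_norm B (x - z) \<le> ip_norm B (x - y) + ip_norm B (y - z)"
  using norm_triangle[of "x - y" "y - z"] by simp

lemma continuous_on_norm [continuous_intros]:
  assumes "continuous_on A f"
  shows "continuous_on A (\<lambda>x. ip_norm B (f x))"
  unfolding ip_norm_def
  by (intro continuous_on_real_sqrt bounded_bilinear.continuous_on[OF bounded_bilinear] assms)

lemma borel_measurable_norm [measurable]: "ip_norm B \<in> borel_measurable borel"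
  by (rule borel_measurable_continuous_onI) (intro continuous_intros)

text \<open>The induced norm attains a positive minimum on the compact Euclidean unit sphere. Hence its
  sublevel sets are bounded, which yields closest points in closed sets.\<close>

lemma norm_coercive:
  obtains m where "0 < m" "\<And>x. m * norm x \<le> ip_norm B x"
proof -
  have "\<exists>m>0. \<forall>x\<in>sphere 0 1. m \<le> ip_norm B x"
  proof (cases "sphere (0::'a) 1 = {}")
    case True
    then show ?thesis by (auto intro: exI[of _ 1])
  next
    case False
    then obtain u where u: "u \<in> sphere 0 1" "\<And>x. x \<in> sphere 0 1 \<Longrightarrow> ip_norm B u \<le> ip_norm B x"
      using continuous_attains_inf[OF compact_sphere False continuous_on_norm[OF continuous_on_id]]
      by blast
    have "u \<noteq> 0" using u(1) by auto
    then have "0 < ip_norm B u"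
      using inner_product by (simp add: ip_norm_def inner_product_def)
    then show ?thesis using u(2) by blast
  qed
  then obtain m where m: "0 < m" "\<And>x. x \<in> sphere 0 1 \<Longrightarrow> m \<le> ip_norm B x" by blast
  have "m * norm x \<le> ip_norm B x" for x
  proof (cases "x = 0")
    case False
    then have "m \<le> ip_norm B ((1 / norm x) *\<^sub>R x)"
      by (intro m(2)) simp
    then show ?thesis
      using False by (simp add: norm_scaleR field_simps)
  qed simp
  then show thesis using m(1) that by blast
qed

lemma bdd_below_dist: "bdd_below (ip_dist B x ` A)"
  by (rule bdd_belowI[of _ 0]) (auto simp: ip_dist_def)

lemma setdist_le: "y \<in> A \<Longrightarrow> ip_setdist B x A \<le> ip_norm B (x - y)"
  using cINF_lower[OF bdd_below_dist, of y A x] by (simp add: ip_setdist_def ip_dist_def)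

lemma setdist_greatest: "A \<noteq> {} \<Longrightarrow> (\<And>y. y \<in> A \<Longrightarrow> c \<le> ip_norm B (x - y)) \<Longrightarrow> c \<le> ip_setdist B x A"
  unfolding ip_setdist_def by (rule cINF_greatest) (simp_all add: ip_dist_def)

lemma setdist_nonneg: "A \<noteq> {} \<Longrightarrow> 0 \<le> ip_setdist B x A"
  by (rule setdist_greatest) simp_all

lemma setdist_singleton [simp]: "ip_setdist B x {y} = ip_dist B x y"
  by (simp add: ip_setdist_def)

lemma setdist_triangle:
  assumes "A \<noteq> {}"
  shows "ip_setdist B x A \<le> ip_norm B (x - y) + ip_setdist B y A"
proof -
  have "ip_setdist B x A - ip_norm B (x - y) \<le> ip_setdist B y A"
    using setdist_le[of _ A x] norm_diff_triangle[of x _ y]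
    by (intro setdist_greatest assms) (smt (verit))
  then show ?thesis by simp
qed

lemma setdist_attained:
  assumes "closed A" "A \<noteq> {}"
  obtains p where "p \<in> A" "ip_setdist B x A = ip_norm B (x - p)"
proof -
  obtain m where m: "0 < m" "\<And>x. m * norm x \<le> ip_norm B x"
    using norm_coercive by blast
  obtain y0 where y0: "y0 \<in> A" using assms by blast
  define K where "K = A \<inter> cball x (ip_norm B (x - y0) / m)"
  have in_K: "y \<in> K" if "y \<in> A" "ip_norm B (x - y) \<le> ip_norm B (x - y0)" for y
    using that m(2)[of "x - y"] m(1) by (simp add: K_def dist_norm field_simps)
  have "\<exists>p\<in>K. \<forall>y\<in>K. ip_norm B (x - p) \<le> ip_norm B (x - y)"
    using assms in_K[OF y0]
    by (intro continuous_attains_inf continuous_intros) (auto simp: K_def)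
  then obtain p where p: "p \<in> K" "\<And>y. y \<in> K \<Longrightarrow> ip_norm B (x - p) \<le> ip_norm B (x - y)"
    by blast
  have "ip_norm B (x - p) \<le> ip_norm B (x - y)" if "y \<in> A" for y
    using p(2)[OF in_K[OF that]] p(2)[OF in_K[OF y0]] by linarith
  then have "ip_setdist B x A = ip_norm B (x - p)"
    using p(1) by (intro antisym setdist_le setdist_greatest) (auto simp: K_def)
  then show thesis using p(1) that by (auto simp: K_def)
qed

lemma continuous_on_setdist:
  assumes "A \<noteq> {}"
  shows "continuous_on UNIV (\<lambda>x. ip_setdist B x A)"
  unfolding continuous_on_def
proof
  fix x
  have "((\<lambda>y. ip_norm B (y - x)) \<longlongrightarrow> ip_norm B (x - x)) (at x)"
    by (rule continuous_on_norm[OF continuous_on_diff[OF continuous_on_id continuous_on_const],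
          unfolded continuous_on_def, THEN bspec]) simp
  then have lim: "((\<lambda>y. ip_norm B (y - x)) \<longlongrightarrow> 0) (at x)"
    by simp
  have "norm (ip_setdist B y A - ip_setdist B x A) \<le> ip_norm B (y - x)" for y
    using setdist_triangle[OF assms, of x y] setdist_triangle[OF assms, of y x]
    by (simp add: abs_le_iff norm_minus_commute[of x y])
  then have "((\<lambda>y. ip_setdist B y A - ip_setdist B x A) \<longlongrightarrow> 0) (at x)"
    by (intro Lim_null_comparison[OF _ lim] always_eventually allI)
  then show "((\<lambda>x. ip_setdist B x A) \<longlongrightarrow> ip_setdist B x A) (at x within UNIV)"
    by (simp add: LIM_zero_iff)
qed

lemma borel_measurable_setdist:
  "A \<noteq> {} \<Longrightarrow> (\<lambda>x. ip_setdist B x A) \<in> borel_measurable borel"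
  by (intro borel_measurable_continuous_onI continuous_on_setdist)

end

section \<open>Recursions driven by independent noise\<close>

primrec driven :: "('s \<Rightarrow> 'r \<Rightarrow> 's) \<Rightarrow> 's \<Rightarrow> nat \<Rightarrow> (nat \<Rightarrow> 'r) \<Rightarrow> 's" where
  "driven \<Phi> s0 0 f = s0"
| "driven \<Phi> s0 (Suc t) f = \<Phi> (driven \<Phi> s0 t f) (f t)"

lemma driven_restrict: "{..<t} \<subseteq> I \<Longrightarrow> driven \<Phi> s0 t (restrict f I) = driven \<Phi> s0 t f"
  by (induction t) (auto simp: subset_iff)

lemma measurable_driven:
  assumes [measurable]: "(\<lambda>(s, \<rho>). \<Phi> s \<rho>) \<in> N \<Otimes>\<^sub>M K \<rightarrow>\<^sub>M N" and "s0 \<in> space N" and "{..<t} \<subseteq> I"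
  shows "driven \<Phi> s0 t \<in> (\<Pi>\<^sub>M i\<in>I. K) \<rightarrow>\<^sub>M N"
  using assms(3)
proof (induction t)
  case 0
  then show ?case using assms(2) by simp
next
  case (Suc t)
  then have "{..<t} \<subseteq> I" and "t \<in> I"
    by auto
  note [measurable] = Suc.IH[OF this(1)]
  from \<open>t \<in> I\<close> show ?case by simp
qed

text \<open>The state at time \<open>t\<close> depends only on the noise before \<open>t\<close>, so the current noise can be
  replaced by an independent copy.\<close>

lemma (in prob_space) nn_integral_driven:
  fixes r :: "nat \<Rightarrow> 'a \<Rightarrow> 'r" and t :: nat
  assumes ind: "indep_vars (\<lambda>_. K) r UNIV"
    and \<Phi>: "(\<lambda>(s, \<rho>). \<Phi> s \<rho>) \<in> N \<Otimes>\<^sub>M K \<rightarrow>\<^sub>M N" and s0: "s0 \<in> space N"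
    and h: "(\<lambda>(s, \<rho>). h s \<rho>) \<in> borel_measurable (N \<Otimes>\<^sub>M K)"
  defines "d \<equiv> \<lambda>\<omega>. driven \<Phi> s0 t (\<lambda>i. r i \<omega>)"
  shows "d \<in> M \<rightarrow>\<^sub>M N"
    and "(\<integral>\<^sup>+\<omega>. h (d \<omega>) (r t \<omega>) \<partial>M) = (\<integral>\<^sup>+\<omega>. \<integral>\<^sup>+\<omega>'. h (d \<omega>) (r t \<omega>') \<partial>M \<partial>M)"
proof -
  define A where "A = (\<Pi>\<^sub>M i\<in>{..<t}. K)"
  define B where "B = (\<Pi>\<^sub>M i\<in>{t}. K)"
  define a where "a \<omega> = restrict (\<lambda>i. r i \<omega>) {..<t}" for \<omega>
  define b where "b \<omega> = restrict (\<lambda>i. r i \<omega>) {t}" for \<omega>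
  have ind_ab: "indep_var A a B b"
    unfolding A_def B_def a_def b_def by (rule indep_var_restrict[OF ind]) auto
  have [measurable]: "a \<in> M \<rightarrow>\<^sub>M A" "b \<in> M \<rightarrow>\<^sub>M B"
    using indep_var_rv1[OF ind_ab] indep_var_rv2[OF ind_ab] .
  have [measurable]: "driven \<Phi> s0 t \<in> A \<rightarrow>\<^sub>M N"
    unfolding A_def by (intro measurable_driven \<Phi> s0) simp
  have [measurable]: "(\<lambda>g. g t) \<in> B \<rightarrow>\<^sub>M K"
    unfolding B_def by simp
  note [measurable] = h
  have d_eq: "d = (\<lambda>\<omega>. driven \<Phi> s0 t (a \<omega>))" and r_eq: "r t = (\<lambda>\<omega>. b \<omega> t)"
    by (simp_all add: d_def a_def b_def driven_restrict)
  show "d \<in> M \<rightarrow>\<^sub>M N"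
    unfolding d_eq by measurable
  interpret PB: prob_space "distr M B b"
    by (rule prob_space_distr) simp
  have "(\<integral>\<^sup>+\<omega>. h (d \<omega>) (r t \<omega>) \<partial>M)
      = (\<integral>\<^sup>+p. h (driven \<Phi> s0 t (fst p)) (snd p t) \<partial>distr M (A \<Otimes>\<^sub>M B) (\<lambda>\<omega>. (a \<omega>, b \<omega>)))"
    by (subst nn_integral_distr) (simp_all add: d_eq r_eq)
  also have "\<dots> = (\<integral>\<^sup>+p. h (driven \<Phi> s0 t (fst p)) (snd p t) \<partial>(distr M A a \<Otimes>\<^sub>M distr M B b))"
    using ind_ab by (simp add: indep_var_distribution_eq)
  also have "\<dots> = (\<integral>\<^sup>+f. \<integral>\<^sup>+g. h (driven \<Phi> s0 t f) (g t) \<partial>distr M B b \<partial>distr M A a)"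
    by (subst PB.nn_integral_fst[symmetric]) simp_all
  also have "\<dots> = (\<integral>\<^sup>+\<omega>. \<integral>\<^sup>+g. h (d \<omega>) (g t) \<partial>distr M B b \<partial>M)"
    by (subst nn_integral_distr) (simp_all add: d_eq)
  also have "\<dots> = (\<integral>\<^sup>+\<omega>. \<integral>\<^sup>+\<omega>'. h (d \<omega>) (r t \<omega>') \<partial>M \<partial>M)"
  proof (rule nn_integral_cong)
    fix \<omega> assume "\<omega> \<in> space M"
    then have [measurable]: "d \<omega> \<in> space N"
      using \<open>d \<in> M \<rightarrow>\<^sub>M N\<close> by (rule measurable_space[rotated])
    show "(\<integral>\<^sup>+g. h (d \<omega>) (g t) \<partial>distr M B b) = (\<integral>\<^sup>+\<omega>'. h (d \<omega>) (r t \<omega>') \<partial>M)"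
      by (subst nn_integral_distr) (simp_all add: r_eq)
  qed
  finally show "(\<integral>\<^sup>+\<omega>. h (d \<omega>) (r t \<omega>) \<partial>M) = (\<integral>\<^sup>+\<omega>. \<integral>\<^sup>+\<omega>'. h (d \<omega>) (r t \<omega>') \<partial>M \<partial>M)" .
qed

text \<open>A Lyapunov function that contracts in expectation has summable expectations along the
  recursion, so the sum of its values is integrable, hence almost surely finite. This gives almost
  sure convergence without a martingale argument.\<close>

lemma (in prob_space) expected_contraction_AE_tendsto_0:
  fixes r :: "nat \<Rightarrow> 'a \<Rightarrow> 'r::topological_space" and s :: "nat \<Rightarrow> 'a \<Rightarrow> 's" and V :: "'s \<Rightarrow> real"
  assumes iid: "iid_seq M r" and rD: "\<And>t \<omega>. \<omega> \<in> space M \<Longrightarrow> r t \<omega> \<in> D"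
    and \<Phi>: "(\<lambda>(s, \<rho>). \<Phi> s \<rho>) \<in> N \<Otimes>\<^sub>M borel \<rightarrow>\<^sub>M N"
    and V: "V \<in> borel_measurable N" and V_nonneg: "\<And>s. 0 \<le> V s"
    and K: "s0 \<in> K" "\<And>s \<rho>. s \<in> K \<Longrightarrow> \<rho> \<in> D \<Longrightarrow> \<Phi> s \<rho> \<in> K" "K \<subseteq> space N"
    and q: "0 \<le> q" "q < 1"
    and drift: "\<And>s. s \<in> K \<Longrightarrow> (\<integral>\<^sup>+\<omega>. ennreal (V (\<Phi> s (r 0 \<omega>))) \<partial>M) \<le> ennreal (q * V s)"
    and s: "\<And>\<omega>. \<omega> \<in> space M \<Longrightarrow> s 0 \<omega> = s0"
      "\<And>t \<omega>. \<omega> \<in> space M \<Longrightarrow> s (Suc t) \<omega> = \<Phi> (s t \<omega>) (r t \<omega>)"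
  shows "AE \<omega> in M. (\<lambda>t. V (s t \<omega>)) \<longlonglongrightarrow> 0"
proof -
  note [measurable] = \<Phi> V
  define d where "d t \<omega> = driven \<Phi> s0 t (\<lambda>i. r i \<omega>)" for t \<omega>
  have s_eq: "s t \<omega> = d t \<omega>" if "\<omega> \<in> space M" for t \<omega>
    by (induction t) (simp_all add: d_def s that)
  have d_K: "d t \<omega> \<in> K" if "\<omega> \<in> space M" for t \<omega>
    by (induction t) (simp_all add: d_def K rD that)
  have ind: "indep_vars (\<lambda>_. borel) r UNIV" and same_law: "distr M borel (r t) = distr M borel (r 0)" for t
    using iid by (simp_all add: iid_seq_def)
  have [measurable]: "r t \<in> borel_measurable M" for t
    using ind by (simp add: indep_vars_def)
  have s0_N: "s0 \<in> space N"
    using K by blast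
  have V\<Phi> [measurable]: "(\<lambda>(s, \<rho>). ennreal (V (\<Phi> s \<rho>))) \<in> borel_measurable (N \<Otimes>\<^sub>M borel)"
    by measurable
  note drv = nn_integral_driven[OF ind \<Phi> s0_N V\<Phi>, folded d_def]
  have [measurable]: "d t \<in> M \<rightarrow>\<^sub>M N" for t
    using drv(1)[of t] by (simp add: d_def[abs_def])
  define v where "v t = (\<integral>\<^sup>+\<omega>. ennreal (V (d t \<omega>)) \<partial>M)" for t
  have step: "v (Suc t) \<le> ennreal q * v t" for t
  proof -
    have "v (Suc t) = (\<integral>\<^sup>+\<omega>. ennreal (V (\<Phi> (d t \<omega>) (r t \<omega>))) \<partial>M)"
      by (simp add: v_def d_def)
    also have "\<dots> = (\<integral>\<^sup>+\<omega>. \<integral>\<^sup>+\<omega>'. ennreal (V (\<Phi> (d t \<omega>) (r t \<omega>'))) \<partial>M \<partial>M)"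
      by (rule drv(2))
    also have "\<dots> = (\<integral>\<^sup>+\<omega>. \<integral>\<^sup>+\<omega>'. ennreal (V (\<Phi> (d t \<omega>) (r 0 \<omega>'))) \<partial>M \<partial>M)"
    proof (rule nn_integral_cong)
      fix \<omega> assume "\<omega> \<in> space M"
      then have [measurable]: "d t \<omega> \<in> space N"
        using d_K K by blast
      have "(\<integral>\<^sup>+\<omega>'. ennreal (V (\<Phi> (d t \<omega>) (r i \<omega>'))) \<partial>M)
          = (\<integral>\<^sup>+\<rho>. ennreal (V (\<Phi> (d t \<omega>) \<rho>)) \<partial>distr M borel (r i))" for i
        by (subst nn_integral_distr) simp_all
      then show "(\<integral>\<^sup>+\<omega>'. ennreal (V (\<Phi> (d t \<omega>) (r t \<omega>'))) \<partial>M)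
          = (\<integral>\<^sup>+\<omega>'. ennreal (V (\<Phi> (d t \<omega>) (r 0 \<omega>'))) \<partial>M)"
        by (simp only: same_law[of t])
    qed
    also have "\<dots> \<le> (\<integral>\<^sup>+\<omega>. ennreal q * ennreal (V (d t \<omega>)) \<partial>M)"
      using drift[OF d_K] q V_nonneg by (intro nn_integral_mono) (simp add: ennreal_mult)
    also have "\<dots> = ennreal q * v t"
      by (simp add: v_def nn_integral_cmult)
    finally show ?thesis .
  qed
  have v_le: "v t \<le> ennreal (V s0 * q ^ t)" for t
  proof (induction t)
    case 0
    then show ?case by (simp add: v_def d_def emeasure_space_1)
  next
    case (Suc t)
    have "v (Suc t) \<le> ennreal q * ennreal (V s0 * q ^ t)"
      using step Suc by (meson mult_left_mono order_trans zero_le)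
    also have "\<dots> = ennreal (V s0 * q ^ Suc t)"
      using q V_nonneg by (simp add: ennreal_mult[symmetric] mult_ac)
    finally show ?case .
  qed
  have sm: "summable (\<lambda>t. V s0 * q ^ t)"
    using q by (intro summable_mult summable_geometric) simp
  have "(\<integral>\<^sup>+\<omega>. (\<Sum>t. ennreal (V (d t \<omega>))) \<partial>M) = (\<Sum>t. v t)"
    unfolding v_def by (rule nn_integral_suminf) measurable
  also have "\<dots> \<le> (\<Sum>t. ennreal (V s0 * q ^ t))"
    by (intro suminf_le v_le) auto
  also have "\<dots> = ennreal (\<Sum>t. V s0 * q ^ t)"
    using q V_nonneg sm by (intro suminf_ennreal2) auto
  finally have "(\<integral>\<^sup>+\<omega>. (\<Sum>t. ennreal (V (d t \<omega>))) \<partial>M) \<noteq> \<infinity>"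
    by (auto simp: top_unique)
  then have "AE \<omega> in M. (\<Sum>t. ennreal (V (d t \<omega>))) \<noteq> \<infinity>"
    by (intro nn_integral_PInf_AE) auto
  then show ?thesis
    using AE_space
  proof eventually_elim
    case (elim \<omega>)
    then have "summable (\<lambda>t. V (d t \<omega>))"
      by (intro summable_suminf_not_top V_nonneg) auto
    then show ?case
      using elim(2) by (simp add: s_eq summable_LIMSEQ_zero)
  qed
qed

section \<open>The interconnected system\<close>

locale interconnection = prob_space M + slow: ip ipS + fast: ip ipF
  for M :: "'w measure"
    and ipS :: "'x::euclidean_space \<Rightarrow> 'x \<Rightarrow> real"
    and ipF :: "'z::euclidean_space \<Rightarrow> 'z \<Rightarrow> real" +
  fixes D :: "'r::second_countable_topology set"
    and r :: "nat \<Rightarrow> 'w \<Rightarrow> 'r"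
    and S :: "'x \<Rightarrow> 'z \<Rightarrow> 'r \<Rightarrow> 'x"
    and F :: "'x \<Rightarrow> 'z \<Rightarrow> 'r \<Rightarrow> 'z"
    and R :: "'x \<Rightarrow> 'r \<Rightarrow> 'x"
    and X :: "'x set" and Z :: "'z set" and Z_FIX :: "'x \<Rightarrow> 'z set"
    and L_FIX c_F L_S L_R :: real
  assumes iid: "iid_seq M r" and r_D: "\<And>t \<omega>. \<omega> \<in> space M \<Longrightarrow> r t \<omega> \<in> D"
    and S_meas: "(\<lambda>(x, z, \<rho>). S x z \<rho>) \<in> borel_measurable borel"
    and F_meas: "(\<lambda>(x, z, \<rho>). F x z \<rho>) \<in> borel_measurable borel"
    and closed_X: "closed X"
    and invariant: "\<And>x z \<rho> \<delta>. \<lbrakk>x \<in> X; z \<in> Z; \<rho> \<in> D; 0 \<le> \<delta>; \<delta> \<le> 1\<rbrakk>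
        \<Longrightarrow> x + \<delta> *\<^sub>R S x z \<rho> \<in> X \<and> F x z \<rho> \<in> Z"
    and Z_FIX: "\<And>x. x \<in> X \<Longrightarrow> Z_FIX x \<subseteq> Z \<and> Z_FIX x \<noteq> {} \<and> closed (Z_FIX x)"
    and L_FIX_pos: "0 < L_FIX"
    and Z_FIX_Lipschitz: "\<And>x x' z. \<lbrakk>x \<in> X; x' \<in> X; z \<in> Z_FIX x\<rbrakk>
        \<Longrightarrow> ip_setdist ipF z (Z_FIX x') \<le> L_FIX * ip_norm ipS (x - x')"
    and c_F: "0 < c_F" "c_F < 1"
    and F_contraction: "\<And>x z. \<lbrakk>x \<in> X; z \<in> Z\<rbrakk>
        \<Longrightarrow> (\<integral>\<^sup>+\<omega>. ennreal (ip_setdist ipF (F x z (r 0 \<omega>)) (Z_FIX x)) \<partial>M)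
           \<le> ennreal (c_F * ip_setdist ipF z (Z_FIX x))"
    and R_eq: "\<And>x z \<rho>. \<lbrakk>x \<in> X; z \<in> Z_FIX x; \<rho> \<in> D\<rbrakk> \<Longrightarrow> R x \<rho> = S x z \<rho>"
    and L_S_pos: "0 < L_S" and L_R_pos: "0 < L_R"
    and S_Lipschitz: "\<And>x z z' \<rho>. \<lbrakk>x \<in> X; z \<in> Z; z' \<in> Z; \<rho> \<in> D\<rbrakk>
        \<Longrightarrow> ip_norm ipS (S x z \<rho> - S x z' \<rho>) \<le> L_S * ip_norm ipF (z - z')"
    and R_Lipschitz: "\<And>x x' \<rho>. \<lbrakk>x \<in> X; x' \<in> X; \<rho> \<in> D\<rbrakk>
        \<Longrightarrow> ip_norm ipS (R x \<rho> - R x' \<rho>) \<le> L_R * ip_norm ipS (x - x')"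
begin

abbreviation X_fix :: "'x set" where
  "X_fix \<equiv> fix_set X D R"

definition fast_error :: "'x \<Rightarrow> 'z \<Rightarrow> real" where
  "fast_error x z = ip_setdist ipF z (Z_FIX x)"

lemma r_meas [measurable]: "r t \<in> borel_measurable M"
  using iid by (simp add: iid_seq_def indep_vars_def)

lemma S_meas' [measurable (raw)]:
  assumes "f \<in> borel_measurable N" "g \<in> borel_measurable N" "h \<in> borel_measurable N"
  shows "(\<lambda>\<omega>. S (f \<omega>) (g \<omega>) (h \<omega>)) \<in> borel_measurable N"
  using measurable_compose[OF borel_measurable_Pair[OF assms(1) borel_measurable_Pair[OF assms(2,3)]] S_meas]
  by simp

lemma F_meas' [measurable (raw)]:
  assumes "f \<in> borel_measurable N" "g \<in> borel_measurable N" "h \<in> borel_measurable N"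
  shows "(\<lambda>\<omega>. F (f \<omega>) (g \<omega>) (h \<omega>)) \<in> borel_measurable N"
  using measurable_compose[OF borel_measurable_Pair[OF assms(1) borel_measurable_Pair[OF assms(2,3)]] F_meas]
  by simp

text \<open>The set \<open>D\<close> need not be Borel. On \<open>X\<close> this causes no trouble, because there \<open>R\<close> is a section
  of the Borel map \<open>S\<close>.\<close>

lemma R_meas: "x \<in> X \<Longrightarrow> (\<lambda>\<omega>. R x (r t \<omega>)) \<in> borel_measurable M"
proof -
  assume x: "x \<in> X"
  then obtain z where z: "z \<in> Z_FIX x" using Z_FIX by blast
  have "(\<lambda>\<omega>. S x z (r t \<omega>)) \<in> borel_measurable M"
    by measurable
  then show ?thesis
    by (rule measurable_cong[THEN iffD2, rotated]) (simp add: R_eq[OF x z] r_D)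
qed

lemma fast_error_nonneg: "x \<in> X \<Longrightarrow> 0 \<le> fast_error x z"
  unfolding fast_error_def using Z_FIX by (intro fast.setdist_nonneg) blast

lemma fast_error_attained:
  assumes "x \<in> X"
  obtains p where "p \<in> Z_FIX x" "fast_error x z = ip_norm ipF (z - p)"
  using Z_FIX[OF assms] fast.setdist_attained[of "Z_FIX x" z] unfolding fast_error_def by blast

lemma fast_error_shift:
  assumes x: "x \<in> X" and x': "x' \<in> X"
  shows "fast_error x' z' \<le> fast_error x z + ip_norm ipF (z' - z) + L_FIX * ip_norm ipS (x - x')"
proof -
  obtain p where p: "p \<in> Z_FIX x" "fast_error x z = ip_norm ipF (z - p)"
    using fast_error_attained[OF x] .
  have "fast_error x' z' \<le> ip_norm ipF (z' - p) + ip_setdist ipF p (Z_FIX x')"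
    unfolding fast_error_def using Z_FIX[OF x'] by (intro fast.setdist_triangle) blast
  also have "ip_norm ipF (z' - p) \<le> ip_norm ipF (z' - z) + ip_norm ipF (z - p)"
    by (rule fast.norm_diff_triangle)
  also have "ip_setdist ipF p (Z_FIX x') \<le> L_FIX * ip_norm ipS (x - x')"
    by (rule Z_FIX_Lipschitz[OF x x' p(1)])
  finally show ?thesis using p(2) by simp
qed

lemma continuous_on_fast_error: "continuous_on (X \<times> UNIV) (\<lambda>s. fast_error (fst s) (snd s))"
  unfolding continuous_on_def
proof
  fix s :: "'x \<times> 'z" assume s: "s \<in> X \<times> UNIV"
  define e where "e s' = ip_norm ipF (snd s' - snd s) + L_FIX * ip_norm ipS (fst s' - fst s)" for s'
  have "continuous_on (X \<times> UNIV) e"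
    unfolding e_def by (intro continuous_intros slow.continuous_on_norm fast.continuous_on_norm)
  then have "(e \<longlongrightarrow> e s) (at s within X \<times> UNIV)"
    unfolding continuous_on_def using s by (rule bspec)
  then have lim: "(e \<longlongrightarrow> 0) (at s within X \<times> UNIV)"
    by (simp add: e_def)
  have "((\<lambda>s'. fast_error (fst s') (snd s') - fast_error (fst s) (snd s)) \<longlongrightarrow> 0)
          (at s within X \<times> UNIV)"
  proof (rule Lim_null_comparison[OF _ lim])
    have "norm (fast_error (fst s') (snd s') - fast_error (fst s) (snd s)) \<le> e s'"
      if "s' \<in> X \<times> UNIV" for s'
      using fast_error_shift[of "fst s" "fst s'" "snd s'" "snd s"]
        fast_error_shift[of "fst s'" "fst s" "snd s" "snd s'"] s that
      by (auto simp: e_def abs_le_iff fast.norm_minus_commute[of "snd s"] slow.norm_minus_commute[of "fst s"])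
    then show "\<forall>\<^sub>F s' in at s within X \<times> UNIV.
        norm (fast_error (fst s') (snd s') - fast_error (fst s) (snd s)) \<le> e s'"
      by (auto simp: eventually_at_filter)
  qed
  then show "((\<lambda>s. fast_error (fst s) (snd s)) \<longlongrightarrow> fast_error (fst s) (snd s)) (at s within X \<times> UNIV)"
    by (simp add: LIM_zero_iff)
qed

text \<open>The slow map is evaluated at \<open>z\<close> instead of at the closest fast equilibrium, which costs an
  error proportional to the fast error.\<close>

lemma S_minus_R:
  assumes "x \<in> X" "z \<in> Z" "\<rho> \<in> D"
  shows "ip_norm ipS (S x z \<rho> - R x \<rho>) \<le> L_S * fast_error x z"
proof -
  obtain p where p: "p \<in> Z_FIX x" "fast_error x z = ip_norm ipF (z - p)"
    using fast_error_attained[OF assms(1)] .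
  then show ?thesis
    using S_Lipschitz[of x z p \<rho>] Z_FIX[of x] assms by (auto simp: R_eq)
qed

text \<open>The set \<open>X_fix\<close> need not be convex: its distance is bounded by the distance to one fixed
  point \<open>p\<close>, and the norm, unlike the set distance, is convex along the segment from \<open>x\<close> to
  \<open>x + R x \<rho>\<close>.\<close>

lemma slow_step:
  assumes "x \<in> X" "z \<in> Z" "\<rho> \<in> D" "p \<in> X_fix" "0 \<le> \<delta>" "\<delta> \<le> 1"
  shows "ip_setdist ipS (x + \<delta> *\<^sub>R S x z \<rho>) X_fix
    \<le> (1 - \<delta>) * ip_norm ipS (x - p) + \<delta> * ip_norm ipS (x + R x \<rho> - p) + \<delta> * (L_S * fast_error x z)"
proof -
  have "ip_setdist ipS (x + \<delta> *\<^sub>R S x z \<rho>) X_fix \<le> ip_norm ipS (x + \<delta> *\<^sub>R S x z \<rho> - p)"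
    using assms(4) by (rule slow.setdist_le)
  also have "x + \<delta> *\<^sub>R S x z \<rho> - p
      = ((1 - \<delta>) *\<^sub>R (x - p) + \<delta> *\<^sub>R (x + R x \<rho> - p)) + \<delta> *\<^sub>R (S x z \<rho> - R x \<rho>)"
    by (simp add: algebra_simps)
  also have "ip_norm ipS \<dots> \<le> ip_norm ipS ((1 - \<delta>) *\<^sub>R (x - p)) + ip_norm ipS (\<delta> *\<^sub>R (x + R x \<rho> - p))
      + ip_norm ipS (\<delta> *\<^sub>R (S x z \<rho> - R x \<rho>))"
    by (rule order_trans[OF slow.norm_triangle add_right_mono[OF slow.norm_triangle]])
  also have "\<dots> = (1 - \<delta>) * ip_norm ipS (x - p) + \<delta> * ip_norm ipS (x + R x \<rho> - p)
      + \<delta> * ip_norm ipS (S x z \<rho> - R x \<rho>)"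
    using assms(5,6) by (simp add: slow.norm_scaleR)
  also have "\<dots> \<le> (1 - \<delta>) * ip_norm ipS (x - p) + \<delta> * ip_norm ipS (x + R x \<rho> - p)
      + \<delta> * (L_S * fast_error x z)"
    using assms S_minus_R[OF assms(1,2,3)] by (intro add_left_mono mult_left_mono)
  finally show ?thesis .
qed

text \<open>The fast error after a step is measured against the moved equilibrium set, and the equilibria
  move at most proportionally to the slow increment, which is small near \<open>X_fix\<close> since \<open>R\<close>
  vanishes there.\<close>

lemma fast_step:
  assumes "x \<in> X" "z \<in> Z" "\<rho> \<in> D" "p \<in> X_fix" "0 \<le> \<delta>" "\<delta> \<le> 1"
  shows "fast_error (x + \<delta> *\<^sub>R S x z \<rho>) (F x z \<rho>)
    \<le> ip_setdist ipF (F x z \<rho>) (Z_FIX x)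
      + L_FIX * (\<delta> * (L_R * ip_norm ipS (x - p) + L_S * fast_error x z))"
proof -
  have p: "p \<in> X" "R p \<rho> = 0"
    using assms by (auto simp: fix_set_def)
  have "ip_norm ipS (S x z \<rho>) \<le> ip_norm ipS (R x \<rho>) + ip_norm ipS (S x z \<rho> - R x \<rho>)"
    using slow.norm_triangle[of "R x \<rho>" "S x z \<rho> - R x \<rho>"] by simp
  also have "\<dots> \<le> L_R * ip_norm ipS (x - p) + L_S * fast_error x z"
    using R_Lipschitz[of x p \<rho>] S_minus_R[of x z \<rho>] p assms by simp
  finally have S_le: "ip_norm ipS (S x z \<rho>) \<le> L_R * ip_norm ipS (x - p) + L_S * fast_error x z" .
  have "fast_error (x + \<delta> *\<^sub>R S x z \<rho>) (F x z \<rho>)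
      \<le> fast_error x (F x z \<rho>) + L_FIX * ip_norm ipS (\<delta> *\<^sub>R S x z \<rho>)"
    using fast_error_shift[of x "x + \<delta> *\<^sub>R S x z \<rho>" "F x z \<rho>" "F x z \<rho>"]
      slow.norm_minus_commute[of x "x + \<delta> *\<^sub>R S x z \<rho>"] invariant assms by auto
  also have "\<dots> \<le> fast_error x (F x z \<rho>)
      + L_FIX * (\<delta> * (L_R * ip_norm ipS (x - p) + L_S * fast_error x z))"
    using L_FIX_pos assms S_le by (auto simp: slow.norm_scaleR intro!: mult_left_mono)
  finally show ?thesis
    by (simp add: fast_error_def)
qed

text \<open>The expected errors \<open>a\<close> (slow) and \<open>b\<close> (fast) obey
  \<open>a' \<le> (1 - \<delta> c_S) a + \<delta> L_S b\<close> and
  \<open>b' \<le> \<delta> L_FIX L_R a + (c_F + \<delta> L_FIX L_S) b\<close>. The combination \<open>a + w b\<close> contracts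
  iff \<open>\<delta> L_S / (1 - c_F - \<delta> L_FIX L_S) < w < c_S / (L_FIX L_R)\<close>, and the condition
  \<open>\<delta> < delta_bar\<close> says exactly that this interval is nonempty.\<close>

lemma contraction_weight:
  assumes c_S: "0 < c_S" and \<delta>: "0 < \<delta>" "\<delta> < delta_bar c_S c_F L_FIX L_S L_R"
  obtains w q where "0 < w" "0 \<le> q" "q < 1"
    "(1 - \<delta> * c_S) + w * (L_FIX * \<delta> * L_R) \<le> q"
    "\<delta> * L_S + w * (c_F + L_FIX * \<delta> * L_S) \<le> q * w"
proof -
  note pos = L_FIX_pos L_S_pos L_R_pos c_S \<delta>(1)
  define g where "g = 1 - c_F - L_FIX * \<delta> * L_S"
  have main: "\<delta> * (L_FIX * L_S * (c_S + L_R)) < c_S * (1 - c_F)"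
    using \<delta> pos by (simp add: delta_bar_def less_divide_eq)
  have "0 < \<delta> * (L_FIX * L_S * L_R)"
    using pos by simp
  then have "c_S * (L_FIX * \<delta> * L_S) < c_S * (1 - c_F)"
    using main by (simp add: algebra_simps)
  then have g: "0 < g"
    using c_S by (simp add: g_def)
  have "\<delta> * L_S * (L_FIX * L_R) < c_S * g"
    using main by (simp add: g_def algebra_simps)
  then have "\<delta> * L_S / g < c_S / (L_FIX * L_R)"
    using g pos by (simp add: divide_simps mult_ac)
  then obtain w where w: "\<delta> * L_S / g < w" "w < c_S / (L_FIX * L_R)"
    using dense by blast
  have "0 < \<delta> * L_S / g" using g pos by simp
  then have w_pos: "0 < w" using w by linarith
  have 1: "w * (L_FIX * L_R) < c_S"
    using w(2) pos by (simp add: field_simps)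
  have 2: "\<delta> * L_S < w * g"
    using w(1) g by (simp add: field_simps)
  define q where "q = max ((1 - \<delta> * c_S) + w * (L_FIX * \<delta> * L_R))
      ((\<delta> * L_S + w * (c_F + L_FIX * \<delta> * L_S)) / w)"
  show thesis
  proof (rule that[OF w_pos])
    have "0 \<le> (\<delta> * L_S + w * (c_F + L_FIX * \<delta> * L_S)) / w"
      using w_pos pos c_F by (intro divide_nonneg_pos add_nonneg_nonneg mult_nonneg_nonneg) auto
    then show "0 \<le> q"
      by (simp add: q_def le_max_iff_disj)
    have "\<delta> * (w * (L_FIX * L_R)) < \<delta> * c_S"
      using 1 \<delta>(1) by (rule mult_strict_left_mono)
    then have "(1 - \<delta> * c_S) + w * (L_FIX * \<delta> * L_R) < 1"
      by (simp add: mult_ac)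
    moreover have "(\<delta> * L_S + w * (c_F + L_FIX * \<delta> * L_S)) / w < 1"
      using 2 w_pos by (simp add: g_def algebra_simps)
    ultimately show "q < 1"
      by (simp add: q_def)
    show "(1 - \<delta> * c_S) + w * (L_FIX * \<delta> * L_R) \<le> q"
      by (simp add: q_def)
    have "(\<delta> * L_S + w * (c_F + L_FIX * \<delta> * L_S)) / w \<le> q"
      by (simp add: q_def)
    then show "\<delta> * L_S + w * (c_F + L_FIX * \<delta> * L_S) \<le> q * w"
      using w_pos by (simp add: divide_le_eq)
  qed
qed

lemma expected_drift:
  assumes xz: "x \<in> X" "z \<in> Z" and p: "p \<in> X_fix" "a = ip_norm ipS (x - p)"
    and \<delta>: "0 < \<delta>" "\<delta> < 1" and w: "0 < w"
    and slow_nonneg: "0 \<le> (1 - c_S) * a"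
    and slow: "(\<integral>\<^sup>+\<omega>. ennreal (ip_norm ipS (x + R x (r 0 \<omega>) - p)) \<partial>M) \<le> ennreal ((1 - c_S) * a)"
    and q: "(1 - \<delta> * c_S) + w * (L_FIX * \<delta> * L_R) \<le> q"
      "\<delta> * L_S + w * (c_F + L_FIX * \<delta> * L_S) \<le> q * w"
  shows "(\<integral>\<^sup>+\<omega>. ennreal (ip_setdist ipS (x + \<delta> *\<^sub>R S x z (r 0 \<omega>)) X_fix
            + w * fast_error (x + \<delta> *\<^sub>R S x z (r 0 \<omega>)) (F x z (r 0 \<omega>))) \<partial>M)
    \<le> ennreal (q * (a + w * fast_error x z))"
proof -
  define b where "b = fast_error x z"
  define u where "u \<omega> = ip_norm ipS (x + R x (r 0 \<omega>) - p)" for \<omega>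
  define v where "v \<omega> = ip_setdist ipF (F x z (r 0 \<omega>)) (Z_FIX x)" for \<omega>
  define c where "c = (1 - \<delta>) * a + \<delta> * (L_S * b) + w * (L_FIX * (\<delta> * (L_R * a + L_S * b)))"
  have [simp]: "0 \<le> a" "0 \<le> b"
    using fast_error_nonneg[OF xz(1)] by (auto simp: p(2) b_def)
  have [simp]: "0 \<le> u \<omega>" "0 \<le> v \<omega>" for \<omega>
    using Z_FIX[OF xz(1)] by (auto simp: u_def v_def intro!: fast.setdist_nonneg)
  have [simp]: "0 \<le> c"
    unfolding c_def using \<delta> w L_S_pos L_R_pos L_FIX_pos
    by (intro add_nonneg_nonneg mult_nonneg_nonneg) auto
  note [measurable] = R_meas[OF xz(1)]
  have [measurable]: "u \<in> borel_measurable M"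
    unfolding u_def by measurable
  have [measurable]: "(\<lambda>y. ip_setdist ipF y (Z_FIX x)) \<in> borel_measurable borel"
    using Z_FIX[OF xz(1)] by (intro fast.borel_measurable_setdist) blast
  have [measurable]: "v \<in> borel_measurable M"
    unfolding v_def by measurable
  have "(\<integral>\<^sup>+\<omega>. ennreal (ip_setdist ipS (x + \<delta> *\<^sub>R S x z (r 0 \<omega>)) X_fix
            + w * fast_error (x + \<delta> *\<^sub>R S x z (r 0 \<omega>)) (F x z (r 0 \<omega>))) \<partial>M)
      \<le> (\<integral>\<^sup>+\<omega>. (ennreal c + ennreal \<delta> * ennreal (u \<omega>)) + ennreal w * ennreal (v \<omega>) \<partial>M)"
  proof (intro nn_integral_mono)
    fix \<omega> assume "\<omega> \<in> space M"
    then have D: "r 0 \<omega> \<in> D" by (rule r_D)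
    have "ip_setdist ipS (x + \<delta> *\<^sub>R S x z (r 0 \<omega>)) X_fix
        \<le> (1 - \<delta>) * a + \<delta> * u \<omega> + \<delta> * (L_S * b)"
      using slow_step[OF xz D p(1), of \<delta>] \<delta> by (simp add: p(2) u_def b_def)
    moreover have "w * fast_error (x + \<delta> *\<^sub>R S x z (r 0 \<omega>)) (F x z (r 0 \<omega>))
        \<le> w * (v \<omega> + L_FIX * (\<delta> * (L_R * a + L_S * b)))"
      using fast_step[OF xz D p(1), of \<delta>] \<delta> w by (intro mult_left_mono) (simp_all add: p(2) v_def b_def)
    ultimately have "ip_setdist ipS (x + \<delta> *\<^sub>R S x z (r 0 \<omega>)) X_fix
        + w * fast_error (x + \<delta> *\<^sub>R S x z (r 0 \<omega>)) (F x z (r 0 \<omega>)) \<le> c + \<delta> * u \<omega> + w * v \<omega>"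
      by (simp add: c_def algebra_simps)
    also have "ennreal (c + \<delta> * u \<omega> + w * v \<omega>)
        = (ennreal c + ennreal \<delta> * ennreal (u \<omega>)) + ennreal w * ennreal (v \<omega>)"
      using \<delta> w by (simp add: ennreal_mult)
    finally show "ennreal (ip_setdist ipS (x + \<delta> *\<^sub>R S x z (r 0 \<omega>)) X_fix
        + w * fast_error (x + \<delta> *\<^sub>R S x z (r 0 \<omega>)) (F x z (r 0 \<omega>)))
        \<le> (ennreal c + ennreal \<delta> * ennreal (u \<omega>)) + ennreal w * ennreal (v \<omega>)"
      by (simp add: ennreal_leI)
  qed
  also have "\<dots> = ennreal c + ennreal \<delta> * (\<integral>\<^sup>+\<omega>. ennreal (u \<omega>) \<partial>M) + ennreal w * (\<integral>\<^sup>+\<omega>. ennreal (v \<omega>) \<partial>M)"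
    by (simp add: nn_integral_add nn_integral_cmult emeasure_space_1)
  also have "\<dots> \<le> ennreal c + ennreal \<delta> * ennreal ((1 - c_S) * a) + ennreal w * ennreal (c_F * b)"
    using slow F_contraction[OF xz]
    by (intro add_mono mult_left_mono) (simp_all add: u_def v_def b_def fast_error_def)
  also have "\<dots> = ennreal (c + \<delta> * ((1 - c_S) * a) + w * (c_F * b))"
    using \<delta> w c_F slow_nonneg by (simp add: ennreal_mult'[symmetric])
  also have "\<dots> \<le> ennreal (q * (a + w * b))"
  proof (rule ennreal_leI)
    have "c + \<delta> * ((1 - c_S) * a) + w * (c_F * b)
        = ((1 - \<delta> * c_S) + w * (L_FIX * \<delta> * L_R)) * a + (\<delta> * L_S + w * (c_F + L_FIX * \<delta> * L_S)) * b"
      by (simp add: c_def algebra_simps)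
    also have "\<dots> \<le> q * a + q * w * b"
      using q by (intro add_mono mult_right_mono) simp_all
    finally show "c + \<delta> * ((1 - c_S) * a) + w * (c_F * b) \<le> q * (a + w * b)"
      by (simp add: algebra_simps)
  qed
  finally show ?thesis by (simp add: b_def)
qed

theorem AE_convergence:
  assumes fixed: "X_fix \<noteq> {}" "closed X_fix" and c_S: "0 < c_S"
    and slow_nonneg: "\<And>x. x \<in> X \<Longrightarrow> 0 \<le> (1 - c_S) * ip_setdist ipS x X_fix"
    and slow: "\<And>x p. \<lbrakk>x \<in> X; p \<in> X_fix; ip_setdist ipS x X_fix = ip_norm ipS (x - p)\<rbrakk>
        \<Longrightarrow> (\<integral>\<^sup>+\<omega>. ennreal (ip_norm ipS (x + R x (r 0 \<omega>) - p)) \<partial>M)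
           \<le> ennreal ((1 - c_S) * ip_setdist ipS x X_fix)"
    and \<delta>: "0 < \<delta>" "\<delta> < delta_bar c_S c_F L_FIX L_S L_R" "\<delta> < 1"
    and init: "x0 \<in> X" "z0 \<in> Z" and traj: "trajectory M S F r \<delta> x0 z0 x z"
  shows "AE \<omega> in M. (\<lambda>t. norm (vector [ip_setdist ipS (x t \<omega>) X_fix,
                                       ip_setdist ipF (z t \<omega>) (Z_FIX (x t \<omega>))] :: real ^ 2))
                     \<longlonglongrightarrow> 0"
proof -
  obtain w q where w: "0 < w" and q: "0 \<le> q" "q < 1"
      "(1 - \<delta> * c_S) + w * (L_FIX * \<delta> * L_R) \<le> q"
      "\<delta> * L_S + w * (c_F + L_FIX * \<delta> * L_S) \<le> q * w"
    using contraction_weight[OF c_S \<delta>(1,2)] .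
  define \<Phi> where "\<Phi> s \<rho> = (fst s + \<delta> *\<^sub>R S (fst s) (snd s) \<rho>, F (fst s) (snd s) \<rho>)" for s \<rho>
  define W where "W s = ip_setdist ipS (fst s) X_fix + w * fast_error (fst s) (snd s)" for s
  \<comment> \<open>Off \<open>X\<close> the sets \<open>Z_FIX x\<close> are arbitrary; cutting the Lyapunov function off there makes it
    Borel and nonnegative.\<close>
  define V where "V s = indicator (X \<times> UNIV) s *\<^sub>R W s" for s
  have V_eq: "V s = W s" if "fst s \<in> X" for s
    using that by (simp add: V_def indicator_def mem_Times_iff)
  have V_nonneg: "0 \<le> V s" for s
    using w fast_error_nonneg[of "fst s" "snd s"] slow.setdist_nonneg[OF fixed(1), of "fst s"]
    by (auto simp: V_def W_def indicator_def)
  have V_meas: "V \<in> borel_measurable borel"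
    unfolding V_def W_def
  proof (rule borel_measurable_continuous_on_indicator)
    show "X \<times> UNIV \<in> sets borel"
      using closed_X by (intro borel_closed closed_Times closed_UNIV)
    have "continuous_on (X \<times> UNIV) (\<lambda>s. ip_setdist ipS (fst s) X_fix)"
      by (rule continuous_on_compose2[OF slow.continuous_on_setdist[OF fixed(1)]])
         (auto intro: continuous_intros)
    then show "continuous_on (X \<times> UNIV) (\<lambda>s. ip_setdist ipS (fst s) X_fix + w * fast_error (fst s) (snd s))"
      using continuous_on_fast_error by (intro continuous_intros)
  qed
  have \<Phi>_meas: "(\<lambda>(s, \<rho>). \<Phi> s \<rho>) \<in> borel \<Otimes>\<^sub>M borel \<rightarrow>\<^sub>M borel"
  proof -
    have [measurable]: "fst \<in> borel_measurable (borel :: ('x \<times> 'z) measure)"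
      "snd \<in> borel_measurable (borel :: ('x \<times> 'z) measure)"
      by (intro borel_measurable_continuous_onI continuous_intros)+
    show ?thesis
      unfolding \<Phi>_def case_prod_beta by (intro borel_measurable_Pair) measurable
  qed
  have \<Phi>_K: "\<Phi> s \<rho> \<in> X \<times> Z" if "s \<in> X \<times> Z" "\<rho> \<in> D" for s \<rho>
    using invariant[of "fst s" "snd s" \<rho> \<delta>] that \<delta> by (auto simp: \<Phi>_def)
  have drift: "(\<integral>\<^sup>+\<omega>. ennreal (V (\<Phi> s (r 0 \<omega>))) \<partial>M) \<le> ennreal (q * V s)" if s: "s \<in> X \<times> Z" for s
  proof -
    have xz: "fst s \<in> X" "snd s \<in> Z" using s by auto
    obtain p where p: "p \<in> X_fix" "ip_setdist ipS (fst s) X_fix = ip_norm ipS (fst s - p)"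
      using slow.setdist_attained[OF fixed(2,1)] .
    have "(\<integral>\<^sup>+\<omega>. ennreal (V (\<Phi> s (r 0 \<omega>))) \<partial>M) = (\<integral>\<^sup>+\<omega>. ennreal (W (\<Phi> s (r 0 \<omega>))) \<partial>M)"
    proof (intro nn_integral_cong)
      fix \<omega> assume "\<omega> \<in> space M"
      then have "fst (\<Phi> s (r 0 \<omega>)) \<in> X"
        using \<Phi>_K[OF s] r_D by (auto simp: mem_Times_iff)
      then show "ennreal (V (\<Phi> s (r 0 \<omega>))) = ennreal (W (\<Phi> s (r 0 \<omega>)))"
        by (simp add: V_eq)
    qed
    also have "\<dots> \<le> ennreal (q * W s)"
      using expected_drift[OF xz p \<delta>(1,3) w slow_nonneg[OF xz(1)] slow[OF xz(1) p] q(3,4)]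
      by (simp add: W_def \<Phi>_def)
    finally show ?thesis by (simp add: V_eq xz)
  qed
  have "AE \<omega> in M. (\<lambda>t. V (x t \<omega>, z t \<omega>)) \<longlonglongrightarrow> 0"
    using traj init
    by (intro expected_contraction_AE_tendsto_0[OF iid r_D \<Phi>_meas V_meas V_nonneg _ \<Phi>_K _ q(1,2) drift,
          where ?s0.0 = "(x0, z0)"])
       (auto simp: trajectory_def \<Phi>_def)
  then show ?thesis
    using AE_space
  proof eventually_elim
    case (elim \<omega>)
    have xz: "x t \<omega> \<in> X \<and> z t \<omega> \<in> Z" for t
    proof (induction t)
      case 0
      then show ?case using traj init elim(2) by (simp add: trajectory_def)
    next
      case (Suc t)
      then show ?case
        using traj elim(2) invariant[of "x t \<omega>" "z t \<omega>" "r t \<omega>" \<delta>] r_D[OF elim(2)] \<delta>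
        by (simp add: trajectory_def)
    qed
    define a where "a t = ip_setdist ipS (x t \<omega>) X_fix" for t
    define b where "b t = fast_error (x t \<omega>) (z t \<omega>)" for t
    have nonneg: "0 \<le> a t" "0 \<le> b t" for t
      using slow.setdist_nonneg[OF fixed(1)] fast_error_nonneg xz by (auto simp: a_def b_def)
    have "(\<lambda>t. a t + w * b t) \<longlonglongrightarrow> 0"
      using elim(1) xz by (simp add: V_eq W_def a_def b_def)
    then have lim: "(\<lambda>t. (1 + 1 / w) * (a t + w * b t)) \<longlonglongrightarrow> 0"
      by (rule tendsto_mult_right_zero)
    have "norm (vector [a t, b t] :: real ^ 2) \<le> (1 + 1 / w) * (a t + w * b t)" for t
    proof -
      have "norm (vector [a t, b t] :: real ^ 2) \<le> a t + b t"
        using norm_le_l1_cart[of "vector [a t, b t] :: real ^ 2"] nonneg by (simp add: sum_2)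
      also have "\<dots> \<le> (1 + 1 / w) * (a t + w * b t)"
        using nonneg w by (simp add: field_simps)
      finally show ?thesis .
    qed
    then show ?case
      by (intro Lim_null_comparison[OF always_eventually lim]) (simp add: a_def b_def fast_error_def)
  qed
qed

text \<open>If \<open>x \<mapsto> x + R x \<rho> / \<alpha>\<close> is nonexpansive, then \<open>x \<mapsto> x + R x \<rho>\<close> is averaged, and averaged maps
  decrease the squared distance to a fixed point by a multiple of \<open>\<parallel>R x \<rho>\<parallel>\<^sup>2\<close>.\<close>

lemma averaged_decrease:
  assumes \<alpha>: "0 < \<alpha>" and p: "R p \<rho> = 0"
    and nonexp: "ip_norm ipS ((x + (1 / \<alpha>) *\<^sub>R R x \<rho>) - (p + (1 / \<alpha>) *\<^sub>R R p \<rho>)) \<le> ip_norm ipS (x - p)"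
  shows "(ip_norm ipS (x + R x \<rho> - p))\<^sup>2
    \<le> (ip_norm ipS (x - p))\<^sup>2 - (1 - \<alpha>) / \<alpha> * (ip_norm ipS (R x \<rho>))\<^sup>2"
proof -
  define e where "e = x - p"
  define v where "v = R x \<rho>"
  have "(ip_norm ipS (e + (1 / \<alpha>) *\<^sub>R v))\<^sup>2 \<le> (ip_norm ipS e)\<^sup>2"
    using nonexp by (intro power_mono) (simp_all add: p e_def v_def algebra_simps)
  then have "2 * (1 / \<alpha>) * ipS e v + (1 / \<alpha>) * (1 / \<alpha>) * ipS v v \<le> 0"
    by (simp add: slow.norm_sq slow.bilinear_simps slow.sym[of v e] algebra_simps add_divide_distrib)
  then have "\<alpha> * (2 * (1 / \<alpha>) * ipS e v + (1 / \<alpha>) * (1 / \<alpha>) * ipS v v) \<le> 0"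
    using \<alpha> by (intro mult_nonneg_nonpos) simp_all
  then have "2 * ipS e v + ipS v v / \<alpha> \<le> 0"
    using \<alpha> by (simp add: algebra_simps)
  then have "(ip_norm ipS (e + v))\<^sup>2 \<le> (ip_norm ipS e)\<^sup>2 - (1 - \<alpha>) / \<alpha> * (ip_norm ipS v)\<^sup>2"
    using \<alpha> by (simp add: slow.norm_sq slow.bilinear_simps slow.sym[of v e] diff_divide_distrib algebra_simps)
  then show ?thesis by (simp add: e_def v_def algebra_simps)
qed

text \<open>Two applications of \<open>E[Y]\<^sup>2 \<le> E[Y\<^sup>2]\<close> turn the decrease of squared distances and the error bound
  into a contraction of the expected distance. The radicand can be negative only if
  \<open>a = 0\<close>; the inequality still holds then, because \<open>sqrt (k * a\<^sup>2) = sqrt k * a\<close> for every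
  real \<open>k\<close>.\<close>

lemma averaged_contraction:
  assumes \<alpha>: "0 < \<alpha>" "\<alpha> < 1" and \<mu>: "1 \<le> \<mu>"
    and nonexp: "\<And>x x' \<rho>. \<lbrakk>x \<in> X; x' \<in> X; \<rho> \<in> D\<rbrakk> \<Longrightarrow>
           ip_norm ipS ((x + (1 / \<alpha>) *\<^sub>R R x \<rho>) - (x' + (1 / \<alpha>) *\<^sub>R R x' \<rho>)) \<le> ip_norm ipS (x - x')"
    and x: "x \<in> X" and p: "p \<in> X_fix" and a: "a = ip_norm ipS (x - p)"
    and error_bound: "ennreal a \<le> ennreal \<mu> * (\<integral>\<^sup>+\<omega>. ennreal (ip_norm ipS (R x (r 0 \<omega>))) \<partial>M)"
  defines "c \<equiv> sqrt (1 - (1 - \<alpha>) / (\<alpha> * \<mu>\<^sup>2))"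
  shows "0 \<le> c * a"
    and "(\<integral>\<^sup>+\<omega>. ennreal (ip_norm ipS (x + R x (r 0 \<omega>) - p)) \<partial>M) \<le> ennreal (c * a)"
proof -
  define k where "k = (1 - \<alpha>) / \<alpha>"
  define u where "u \<omega> = ip_norm ipS (x + R x (r 0 \<omega>) - p)" for \<omega>
  define v where "v \<omega> = ip_norm ipS (R x (r 0 \<omega>))" for \<omega>
  have k: "0 < k" using \<alpha> by (simp add: k_def)
  have nonneg [simp]: "0 \<le> a" "0 \<le> u \<omega>" "0 \<le> v \<omega>" for \<omega>
    by (simp_all add: a u_def v_def)
  note [measurable] = R_meas[OF x]
  have [measurable]: "u \<in> borel_measurable M" "v \<in> borel_measurable M"
    unfolding u_def v_def by measurable
  have dec: "(u \<omega>)\<^sup>2 \<le> a\<^sup>2 - k * (v \<omega>)\<^sup>2" if "\<omega> \<in> space M" for \<omega>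
  proof -
    have "r 0 \<omega> \<in> D" using r_D that .
    then show ?thesis
      using averaged_decrease[of \<alpha> p "r 0 \<omega>" x] nonexp[of x p "r 0 \<omega>"] p x \<alpha>
      by (simp add: fix_set_def a k_def u_def v_def)
  qed
  have sq_bounds: "(u \<omega>)\<^sup>2 \<le> a\<^sup>2" "(v \<omega>)\<^sup>2 \<le> a\<^sup>2 / k" if "\<omega> \<in> space M" for \<omega>
  proof -
    have "0 \<le> (u \<omega>)\<^sup>2" "0 \<le> k * (v \<omega>)\<^sup>2"
      using k by simp_all
    with dec[OF that] have "(u \<omega>)\<^sup>2 \<le> a\<^sup>2" "k * (v \<omega>)\<^sup>2 \<le> a\<^sup>2"
      by linarith+
    then show "(u \<omega>)\<^sup>2 \<le> a\<^sup>2" "(v \<omega>)\<^sup>2 \<le> a\<^sup>2 / k"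
      using k by (simp_all add: pos_le_divide_eq mult.commute)
  qed
  have int_sq [simp]: "integrable M (\<lambda>\<omega>. (u \<omega>)\<^sup>2)" "integrable M (\<lambda>\<omega>. (v \<omega>)\<^sup>2)"
    by (rule integrable_const_bound[where B = "a\<^sup>2"]; use sq_bounds in auto)
       (rule integrable_const_bound[where B = "a\<^sup>2 / k"]; use sq_bounds in auto)
  have int [simp]: "integrable M u" "integrable M v"
    by (rule square_integrable_imp_integrable; simp)+
  have Jensen: "(expectation f)\<^sup>2 \<le> expectation (\<lambda>\<omega>. (f \<omega>)\<^sup>2)"
    if "integrable M f" "integrable M (\<lambda>\<omega>. (f \<omega>)\<^sup>2)" for f :: "'w \<Rightarrow> real"
    using variance_eq[OF that] variance_positive[of f] by simp
  have Ev: "(\<integral>\<^sup>+\<omega>. ennreal (v \<omega>) \<partial>M) = ennreal (expectation v)"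
    and Eu: "(\<integral>\<^sup>+\<omega>. ennreal (u \<omega>) \<partial>M) = ennreal (expectation u)"
    by (simp_all add: nn_integral_eq_integral)
  have "ennreal a \<le> ennreal (\<mu> * expectation v)"
    using error_bound \<mu> unfolding v_def[symmetric] Ev by (simp add: ennreal_mult)
  then have "a \<le> \<mu> * expectation v"
    using \<mu> by (simp add: integral_nonneg_AE)
  then have "a\<^sup>2 \<le> (\<mu> * expectation v)\<^sup>2"
    by (intro power_mono) simp_all
  also have "\<dots> \<le> \<mu>\<^sup>2 * expectation (\<lambda>\<omega>. (v \<omega>)\<^sup>2)"
    using Jensen[of v] by (simp add: power_mult_distrib mult_left_mono)
  finally have lower: "a\<^sup>2 / \<mu>\<^sup>2 \<le> expectation (\<lambda>\<omega>. (v \<omega>)\<^sup>2)"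
    using \<mu> by (simp add: divide_le_eq mult.commute)
  have "(expectation u)\<^sup>2 \<le> expectation (\<lambda>\<omega>. (u \<omega>)\<^sup>2)"
    by (simp add: Jensen)
  also have "\<dots> \<le> expectation (\<lambda>\<omega>. a\<^sup>2 - k * (v \<omega>)\<^sup>2)"
    by (intro integral_mono dec) simp_all
  also have "\<dots> = a\<^sup>2 - k * expectation (\<lambda>\<omega>. (v \<omega>)\<^sup>2)"
    by (simp add: prob_space)
  also have "\<dots> \<le> a\<^sup>2 - k * (a\<^sup>2 / \<mu>\<^sup>2)"
    using mult_left_mono[OF lower less_imp_le[OF k]] by linarith
  also have "\<dots> = (1 - (1 - \<alpha>) / (\<alpha> * \<mu>\<^sup>2)) * a\<^sup>2"
    by (simp add: k_def algebra_simps)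
  finally have "expectation u \<le> sqrt ((1 - (1 - \<alpha>) / (\<alpha> * \<mu>\<^sup>2)) * a\<^sup>2)"
    by (rule real_le_rsqrt)
  also have "\<dots> = c * a"
    by (simp add: c_def real_sqrt_mult)
  finally have le: "expectation u \<le> c * a" .
  have "0 \<le> expectation u"
    by (simp add: integral_nonneg_AE)
  from this le show "0 \<le> c * a" by (rule order_trans)
  show "(\<integral>\<^sup>+\<omega>. ennreal (ip_norm ipS (x + R x (r 0 \<omega>) - p)) \<partial>M) \<le> ennreal (c * a)"
    unfolding u_def[symmetric] Eu using le by (rule ennreal_leI)
qed

end

section \<open>Almost sure convergence\<close>

theorem mainTheorem7:
  fixes M :: "'w measure"
    and D :: "(real ^ 'p) set"
    and r :: "nat \<Rightarrow> 'w \<Rightarrow> real ^ 'p"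
    and ipS :: "real ^ 'n \<Rightarrow> real ^ 'n \<Rightarrow> real"
    and ipF :: "real ^ 'm \<Rightarrow> real ^ 'm \<Rightarrow> real"
    and S :: "real ^ 'n \<Rightarrow> real ^ 'm \<Rightarrow> real ^ 'p \<Rightarrow> real ^ 'n"
    and F :: "real ^ 'n \<Rightarrow> real ^ 'm \<Rightarrow> real ^ 'p \<Rightarrow> real ^ 'm"
    and R :: "real ^ 'n \<Rightarrow> real ^ 'p \<Rightarrow> real ^ 'n"
    and X :: "(real ^ 'n) set"
    and Z :: "(real ^ 'm) set"
    and Z_FIX :: "real ^ 'n \<Rightarrow> (real ^ 'm) set"
    and L_FIX c_F L_S L_R :: real
  assumes "prob_space M" and "complete_measure M"
    and "iid_seq M r" and "\<forall>t. \<forall>\<omega>\<in>space M. r t \<omega> \<in> D"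
    and "inner_product ipS" and "inner_product ipF"
    and "(\<lambda>(x, z, \<rho>). S x z \<rho>) \<in> borel_measurable borel"
    and "(\<lambda>(x, z, \<rho>). F x z \<rho>) \<in> borel_measurable borel"
    and "(\<lambda>(x, \<rho>). R x \<rho>) \<in> borel_measurable (restrict_space borel (UNIV \<times> D))"
    \<comment> \<open>(1)\<close>
    and "closed X" and "closed Z"
    and "\<forall>x\<in>X. \<forall>z\<in>Z. \<forall>\<rho>\<in>D. \<forall>\<delta>'\<in>{0..1}. x + \<delta>' *\<^sub>R S x z \<rho> \<in> X \<and> F x z \<rho> \<in> Z"
    \<comment> \<open>(2)\<close>
    and "\<forall>x\<in>X. Z_FIX x \<subseteq> Z \<and> Z_FIX x \<noteq> {} \<and> closed (Z_FIX x)"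
    and "\<forall>\<rho>\<in>D. \<forall>x\<in>X. \<forall>zb\<in>Z_FIX x. zb = F x zb \<rho>"
    and "L_FIX > 0"
    and "\<forall>x\<in>X. \<forall>x'\<in>X. \<forall>z\<in>Z_FIX x. ip_setdist ipF z (Z_FIX x') \<le> L_FIX * ip_dist ipS x x'"
    \<comment> \<open>(3)\<close>
    and "0 < c_F" and "c_F < 1"
    and "\<forall>x\<in>X. \<forall>z\<in>Z.
           (\<integral>\<^sup>+ \<omega>. ennreal (ip_setdist ipF (F x z (r 0 \<omega>)) (Z_FIX x)) \<partial>M)
             \<le> ennreal (c_F * ip_setdist ipF z (Z_FIX x))"
    \<comment> \<open>(4)\<close>
    and "\<forall>x\<in>X. \<forall>z\<in>Z_FIX x. \<forall>\<rho>\<in>D. R x \<rho> = S x z \<rho>"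
    \<comment> \<open>(5)\<close>
    and "L_S > 0" and "L_R > 0"
    and "\<forall>x\<in>X. \<forall>z\<in>Z. \<forall>z'\<in>Z. \<forall>\<rho>\<in>D.
           ip_norm ipS (S x z \<rho> - S x z' \<rho>) \<le> L_S * ip_norm ipF (z - z')"
    and "\<forall>x\<in>X. \<forall>x'\<in>X. \<forall>\<rho>\<in>D.
           ip_norm ipS (R x \<rho> - R x' \<rho>) \<le> L_R * ip_norm ipS (x - x')"
  shows
    \<comment> \<open>(i)\<close>
    "(\<forall>\<alpha> \<mu> :: real.
        fix_set X D R \<noteq> {} \<and> closed (fix_set X D R) \<and> 0 < \<alpha> \<and> \<alpha> < 1 \<and> 1 \<le> \<mu> \<and>
        (\<forall>x\<in>X. \<forall>x'\<in>X. \<forall>\<rho>\<in>D.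
           ip_dist ipS (x + (1 / \<alpha>) *\<^sub>R R x \<rho>) (x' + (1 / \<alpha>) *\<^sub>R R x' \<rho>) \<le> ip_norm ipS (x - x')) \<and>
        (\<forall>x\<in>X. ennreal (ip_setdist ipS x (fix_set X D R))
                  \<le> ennreal \<mu> * (\<integral>\<^sup>+ \<omega>. ennreal (ip_norm ipS (R x (r 0 \<omega>))) \<partial>M))
        \<longrightarrow>
        (let c_S = 1 - sqrt (1 - (1 - \<alpha>) / (\<alpha> * \<mu>\<^sup>2)) in
         \<forall>\<delta> x0 z0 x z.
           0 < \<delta> \<and> \<delta> < min (delta_bar c_S c_F L_FIX L_S L_R) 1 \<and> x0 \<in> X \<and> z0 \<in> Z \<and>
           trajectory M S F r \<delta> x0 z0 x z
           \<longrightarrow> (AE \<omega> in M.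
                 (\<lambda>t. norm (vector [ip_setdist ipS (x t \<omega>) (fix_set X D R),
                                    ip_setdist ipF (z t \<omega>) (Z_FIX (x t \<omega>))] :: real ^ 2))
                 \<longlonglongrightarrow> 0)))
     \<and>
     (\<forall>x_star\<in>X. \<forall>c_S :: real.
        0 < c_S \<and> c_S < 1 \<and> fix_set X D R = {x_star} \<and>
        (\<forall>x\<in>X. (\<integral>\<^sup>+ \<omega>. ennreal (ip_dist ipS (x + R x (r 0 \<omega>)) x_star) \<partial>M)
                  \<le> ennreal ((1 - c_S) * ip_dist ipS x x_star))
        \<longrightarrow>
        (\<forall>\<delta> x0 z0 x z.
           0 < \<delta> \<and> \<delta> < min (delta_bar c_S c_F L_FIX L_S L_R) 1 \<and> x0 \<in> X \<and> z0 \<in> Z \<and>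
           trajectory M S F r \<delta> x0 z0 x z
           \<longrightarrow> (AE \<omega> in M.
                 (\<lambda>t. norm (vector [ip_dist ipS (x t \<omega>) x_star,
                                    ip_setdist ipF (z t \<omega>) (Z_FIX (x t \<omega>))] :: real ^ 2))
                 \<longlonglongrightarrow> 0)))"
proof -
  interpret interconnection M ipS ipF D r S F R X Z Z_FIX L_FIX c_F L_S L_R
    by (intro interconnection.intro ip.intro interconnection_axioms.intro)
       (use assms in \<open>auto simp: ip_dist_def\<close>)
  have part1: "AE \<omega> in M. (\<lambda>t. norm (vector [ip_setdist ipS (x t \<omega>) (fix_set X D R),
                                    ip_setdist ipF (z t \<omega>) (Z_FIX (x t \<omega>))] :: real ^ 2)) \<longlonglongrightarrow> 0"
    if fixed: "fix_set X D R \<noteq> {}" "closed (fix_set X D R)" and par: "0 < \<alpha>" "\<alpha> < 1" "1 \<le> \<mu>"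
      and nonexp: "\<forall>x\<in>X. \<forall>x'\<in>X. \<forall>\<rho>\<in>D.
           ip_dist ipS (x + (1 / \<alpha>) *\<^sub>R R x \<rho>) (x' + (1 / \<alpha>) *\<^sub>R R x' \<rho>) \<le> ip_norm ipS (x - x')"
      and error_bound: "\<forall>x\<in>X. ennreal (ip_setdist ipS x (fix_set X D R))
           \<le> ennreal \<mu> * (\<integral>\<^sup>+ \<omega>. ennreal (ip_norm ipS (R x (r 0 \<omega>))) \<partial>M)"
      and \<delta>: "0 < \<delta>" "\<delta> < min (delta_bar (1 - sqrt (1 - (1 - \<alpha>) / (\<alpha> * \<mu>\<^sup>2))) c_F L_FIX L_S L_R) 1"
      and start: "x0 \<in> X" "z0 \<in> Z" "trajectory M S F r \<delta> x0 z0 x z"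
    for \<alpha> \<mu> \<delta> x0 z0 x z
  proof (rule AE_convergence[OF fixed])
    have "0 < (1 - \<alpha>) / (\<alpha> * \<mu>\<^sup>2)"
      using par by simp
    then show "0 < 1 - sqrt (1 - (1 - \<alpha>) / (\<alpha> * \<mu>\<^sup>2))"
      by simp
    fix x assume x: "x \<in> X"
    have contr: "0 \<le> sqrt (1 - (1 - \<alpha>) / (\<alpha> * \<mu>\<^sup>2)) * ip_setdist ipS x X_fix"
      "(\<integral>\<^sup>+\<omega>. ennreal (ip_norm ipS (x + R x (r 0 \<omega>) - p)) \<partial>M)
         \<le> ennreal (sqrt (1 - (1 - \<alpha>) / (\<alpha> * \<mu>\<^sup>2)) * ip_setdist ipS x X_fix)"
      if "p \<in> X_fix" "ip_setdist ipS x X_fix = ip_norm ipS (x - p)" for p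
      using averaged_contraction[OF par _ x that] nonexp error_bound x by (simp_all add: ip_dist_def)
    obtain p where p: "p \<in> X_fix" "ip_setdist ipS x X_fix = ip_norm ipS (x - p)"
      using slow.setdist_attained[OF fixed(2,1)] .
    show "0 \<le> (1 - (1 - sqrt (1 - (1 - \<alpha>) / (\<alpha> * \<mu>\<^sup>2)))) * ip_setdist ipS x X_fix"
      using contr(1)[OF p] by simp
    show "(\<integral>\<^sup>+\<omega>. ennreal (ip_norm ipS (x + R x (r 0 \<omega>) - p)) \<partial>M)
        \<le> ennreal ((1 - (1 - sqrt (1 - (1 - \<alpha>) / (\<alpha> * \<mu>\<^sup>2)))) * ip_setdist ipS x X_fix)"
      if "p \<in> X_fix" "ip_setdist ipS x X_fix = ip_norm ipS (x - p)" for p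
      using contr(2)[OF that] by simp
  qed (use \<delta> start in auto)
  have part2: "AE \<omega> in M. (\<lambda>t. norm (vector [ip_dist ipS (x t \<omega>) x_star,
                                    ip_setdist ipF (z t \<omega>) (Z_FIX (x t \<omega>))] :: real ^ 2)) \<longlonglongrightarrow> 0"
    if c_S: "0 < c_S" "c_S < 1" and fixed: "fix_set X D R = {x_star}"
      and contr: "\<forall>x\<in>X. (\<integral>\<^sup>+ \<omega>. ennreal (ip_dist ipS (x + R x (r 0 \<omega>)) x_star) \<partial>M)
           \<le> ennreal ((1 - c_S) * ip_dist ipS x x_star)"
      and \<delta>: "0 < \<delta>" "\<delta> < min (delta_bar c_S c_F L_FIX L_S L_R) 1"
      and start: "x0 \<in> X" "z0 \<in> Z" "trajectory M S F r \<delta> x0 z0 x z"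
    for x_star c_S \<delta> x0 z0 x z
  proof -
    have "AE \<omega> in M. (\<lambda>t. norm (vector [ip_setdist ipS (x t \<omega>) X_fix,
                                    ip_setdist ipF (z t \<omega>) (Z_FIX (x t \<omega>))] :: real ^ 2)) \<longlonglongrightarrow> 0"
      by (rule AE_convergence[of c_S \<delta> x0 z0 x z]) (use c_S contr \<delta> start in \<open>auto simp: fixed ip_dist_def\<close>)
    then show ?thesis
      by (simp add: fixed)
  qed
  show ?thesis
    unfolding Let_def using part1 part2 by blast
qed

end
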